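(* Let $n\ge 1$. Every indecomposable (finite-dimensional complex) representation of the quiver with relations $\widehat{AA}_n$ is, up to isomorphism, of the form $I^\Sigma_{i,j}$ for some $1\le i\le j\le n$ and some $(j-i)$-tuple of signs $\Sigma$. In particular, the quiver $\widehat{AA}_n$ is of finite representation type.
   Context: $\widehat{AA}_n$ is the quiver with vertices $(1),\dots,(n)$, arrows $\alpha_i\colon (i)\to(i+1)$ and $\beta_i\colon(i+1)\to(i)$ for $1\le i\le n-1$, and relations that all 2-cycles are zero: $\alpha_i\beta_i=0=\beta_i\alpha_i$ for all $i=1,\dots,n-1$ ($\widehat{AA}_1$ is a single vertex). A representation assigns a finite-dimensional complex vector space to each vertex and a linear map to each arrow, satisfying the relations. For $1\le i\le j\le n$ and $\Sigma=(\Sigma_1,\dots,\Sigma_{j-i})\in\{+,-\}^{j-i}$, the representation $I^\Sigma_{i,j}$ has $\mathbb{C}$ at each vertex $(k)$ with $i\le k\le j$ and $0$ at the other vertices; for each $1\le l\le j-i$: if $\Sigma_l=+$, the map on the arrow $(i+l-1)\to(i+l)$ is the identity and the map on $(i+l)\to(i+l-1)$ is $0$; if $\Sigma_l=-$, the map on $(i+l-1)\to(i+l)$ is $0$ and the map on $(i+l)\to(i+l-1)$ is the identity. All other maps are $0$. A quiver with relations is of finite representation type if it has finitely many indecomposable finite-dimensional representations up to isomorphism. *)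

theory Defs
  imports Complex_Main "Graph_Theory.Digraph"
begin

text \<open>
  A quiver is a directed multigraph. A path is the list of its arcs in order of traversal;
  all relations considered here are zero relations, i.e. paths that must act as zero.
\<close>

record ('q, 'a) quiver_rel = "('q, 'a) pre_digraph" +
  zero_rels :: "'a list set"

text \<open>
  The vector spaces of a representation are subspaces of one ambient space \<open>'v\<close> whose scalar
  multiplication is \<open>s\<close>. Any finite family of vector spaces embeds into such an ambient
  space (e.g. their direct sum), so this is no restriction as long as \<open>'v\<close> and \<open>s\<close> are kept
  arbitrary. Only the values of \<open>space\<close> at vertices, and of \<open>act a\<close> on the space at the tail of
  the arc \<open>a\<close>, are meaningful.
\<close>

record ('q, 'a, 'v) rep =
  space :: "'q \<Rightarrow> 'v set"
  act :: "'a \<Rightarrow> 'v \<Rightarrow> 'v"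

definition linear_on ::
  "('k \<Rightarrow> 'v::ab_group_add \<Rightarrow> 'v) \<Rightarrow> ('k \<Rightarrow> 'w::ab_group_add \<Rightarrow> 'w)
    \<Rightarrow> 'v set \<Rightarrow> 'w set \<Rightarrow> ('v \<Rightarrow> 'w) \<Rightarrow> bool" where
  "linear_on s t V W f \<longleftrightarrow>
     f ` V \<subseteq> W \<and>
     (\<forall>x\<in>V. \<forall>y\<in>V. f (x + y) = f x + f y) \<and>
     (\<forall>c. \<forall>x\<in>V. f (s c x) = t c (f x))"

definition representation ::
  "('k::field \<Rightarrow> 'v::ab_group_add \<Rightarrow> 'v) \<Rightarrow> ('q, 'a) quiver_rel \<Rightarrow> ('q, 'a, 'v) rep \<Rightarrow> bool" where
  "representation s Q V \<longleftrightarrow>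
     (\<forall>q\<in>verts Q. module.subspace s (space V q) \<and>
        (\<exists>B. finite B \<and> module.span s B = space V q)) \<and>
     (\<forall>a\<in>arcs Q. linear_on s s (space V (tail Q a)) (space V (head Q a)) (act V a)) \<and>
     (\<forall>p\<in>zero_rels Q. \<forall>x\<in>space V (tail Q (hd p)). fold (act V) p x = 0)"

definition isomorphic ::
  "('k::field \<Rightarrow> 'v::ab_group_add \<Rightarrow> 'v) \<Rightarrow> ('k \<Rightarrow> 'w::ab_group_add \<Rightarrow> 'w)
    \<Rightarrow> ('q, 'a) quiver_rel \<Rightarrow> ('q, 'a, 'v) rep \<Rightarrow> ('q, 'a, 'w) rep \<Rightarrow> bool" where
  "isomorphic s t Q V W \<longleftrightarrow>
     (\<exists>\<phi>. (\<forall>q\<in>verts Q. linear_on s t (space V q) (space W q) (\<phi> q) \<and>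
               bij_betw (\<phi> q) (space V q) (space W q)) \<and>
          (\<forall>a\<in>arcs Q. \<forall>x\<in>space V (tail Q a).
               \<phi> (head Q a) (act V a x) = act W a (\<phi> (tail Q a) x)))"

definition subrepresentation ::
  "('k::field \<Rightarrow> 'v::ab_group_add \<Rightarrow> 'v) \<Rightarrow> ('q, 'a) quiver_rel \<Rightarrow> ('q, 'a, 'v) rep
    \<Rightarrow> ('q \<Rightarrow> 'v set) \<Rightarrow> bool" where
  "subrepresentation s Q V U \<longleftrightarrow>
     (\<forall>q\<in>verts Q. module.subspace s (U q) \<and> U q \<subseteq> space V q) \<and>
     (\<forall>a\<in>arcs Q. act V a ` U (tail Q a) \<subseteq> U (head Q a))"

definition zero_family :: "('q, 'a) quiver_rel \<Rightarrow> ('q \<Rightarrow> 'v::zero set) \<Rightarrow> bool" where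
  "zero_family Q U \<longleftrightarrow> (\<forall>q\<in>verts Q. U q = {0})"

definition direct_sum_decomposition ::
  "('q, 'a) quiver_rel \<Rightarrow> ('q, 'a, 'v::ab_group_add) rep
    \<Rightarrow> ('q \<Rightarrow> 'v set) \<Rightarrow> ('q \<Rightarrow> 'v set) \<Rightarrow> bool" where
  "direct_sum_decomposition Q V U W \<longleftrightarrow>
     (\<forall>q\<in>verts Q. space V q = {u + w | u w. u \<in> U q \<and> w \<in> W q} \<and> U q \<inter> W q = {0})"

definition indecomposable ::
  "('k::field \<Rightarrow> 'v::ab_group_add \<Rightarrow> 'v) \<Rightarrow> ('q, 'a) quiver_rel \<Rightarrow> ('q, 'a, 'v) rep \<Rightarrow> bool" where
  "indecomposable s Q V \<longleftrightarrow>
     representation s Q V \<and> \<not> zero_family Q (space V) \<and>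
     (\<forall>U W. subrepresentation s Q V U \<and> subrepresentation s Q V W \<and>
        direct_sum_decomposition Q V U W \<longrightarrow> zero_family Q U \<or> zero_family Q W)"

text \<open>
  Finiteness of the set of isomorphism classes of the indecomposable representations inside the
  ambient space \<open>(s, 'v)\<close>. A fixed \<open>s\<close> only sees representations that fit into \<open>'v\<close>, so the notion
  has to be asserted for every \<open>s\<close>; a single ambient space of infinite dimension already
  contains a copy of every finite-dimensional representation of a quiver.
\<close>

definition finite_rep_type ::
  "('k::field \<Rightarrow> 'v::ab_group_add \<Rightarrow> 'v) \<Rightarrow> ('q, 'a) quiver_rel \<Rightarrow> bool" where
  "finite_rep_type s Q \<longleftrightarrow>
     finite ({V. indecomposable s Q V} //
       {(V, W). indecomposable s Q V \<and> indecomposable s Q W \<and> isomorphic s s Q V W})"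

datatype AA_arrow = Alpha nat | Beta nat

definition AA :: "nat \<Rightarrow> (nat, AA_arrow) quiver_rel" where
  "AA n =
     \<lparr> verts = {1..n},
       arcs = Alpha ` {1..<n} \<union> Beta ` {1..<n},
       tail = case_AA_arrow (\<lambda>i. i) (\<lambda>i. i + 1),
       head = case_AA_arrow (\<lambda>i. i + 1) (\<lambda>i. i),
       zero_rels = (\<Union>i\<in>{1..<n}. {[Alpha i, Beta i], [Beta i, Alpha i]}) \<rparr>"

datatype sign = Plus | Minus

text \<open>
  The edge between \<open>k\<close> and \<open>k + 1\<close> with \<open>i \<le> k < j\<close> carries the sign \<open>\<Sigma>\<^sub>l\<close> with \<open>l = k - i + 1\<close>,
  which is the entry \<open>\<Sigma> ! (k - i)\<close> of the list.
\<close>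

definition I_rep :: "nat \<Rightarrow> nat \<Rightarrow> sign list \<Rightarrow> (nat, AA_arrow, complex) rep" where
  "I_rep i j \<Sigma> =
     \<lparr> space = (\<lambda>k. if i \<le> k \<and> k \<le> j then UNIV else {0}),
       act = case_AA_arrow
         (\<lambda>k x. if i \<le> k \<and> k < j \<and> \<Sigma> ! (k - i) = Plus then x else 0)
         (\<lambda>k x. if i \<le> k \<and> k < j \<and> \<Sigma> ! (k - i) = Minus then x else 0) \<rparr>"

end

theory Submission
  imports Defs
begin

text \<open>
Why the theorem holds: every representation of \<open>AA n\<close> has a \<^emph>\<open>string basis\<close>, that is, a choice of a
basis in each vertex space such that every arrow sends each basis vector to a basis vector or to
zero, and never identifies two basis vectors that it does not kill. Draw the basis vectors as
points and join two of them when an arrow sends one to the other. Since all 2-cycles vanish, a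
basis vector at the vertex \<open>k\<close> has at most one neighbour at \<open>k + 1\<close> and at most one at \<open>k - 1\<close>: for
instance, it cannot both be moved by \<open>\<alpha>\<^sub>k\<close> and be an image under \<open>\<beta>\<^sub>k\<close>. So the picture is a disjoint
union of paths that run monotonically through the vertices. Each path spans a direct summand, and
a path from \<open>i\<close> to \<open>j\<close> is an \<open>I_rep i j \<Sigma>\<close>, where the signs record which of the two arrows realises
each edge. An indecomposable representation therefore consists of exactly one path.

String bases are built by induction on \<open>n\<close>. The obstacle is that a string basis of the part on the
vertices \<open>1, \<dots>, n\<close>, chosen blindly, need not be compatible with the images and kernels of the new
arrows. The induction therefore proves more: given any flag (finite chain of subspaces) in
the space at the last vertex, the basis there can be chosen so that it spans every member of the
flag. For \<open>\<alpha>: V \<rightarrow> W\<close> and \<open>\<beta>: W \<rightarrow> V\<close> with \<open>\<beta>\<alpha> = 0 = \<alpha>\<beta>\<close>, a flag \<open>F\<close> in \<open>W\<close> induces on \<open>V\<close> the subspaces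
\<open>\<beta>(X)\<close> and \<open>\<alpha>\<^sup>-\<^sup>1(X)\<close> for \<open>X \<in> F\<close>. They form a flag again, because every \<open>\<beta>(X)\<close> lies in the image of \<open>\<beta>\<close>,
hence in the kernel of \<open>\<alpha>\<close>, hence in every \<open>\<alpha>\<^sup>-\<^sup>1(Y)\<close> (\<open>flag_pullback\<close>). A basis of \<open>V\<close> adapted to this
flag can be continued to a basis of \<open>W\<close> adapted to \<open>F\<close> (\<open>transport_adapted_basis\<close>), and this is the
induction step of \<open>exists_string_basis\<close>.

Finite type follows because there are finitely many triples \<open>(i, j, \<Sigma>)\<close> and isomorphism is symmetric
and transitive on representations.
\<close>

section \<open>Flags and bases adapted to them\<close>

definition flag :: "('k::field \<Rightarrow> 'v::ab_group_add \<Rightarrow> 'v) \<Rightarrow> 'v set \<Rightarrow> 'v set set \<Rightarrow> bool" where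
  "flag s V F \<longleftrightarrow> finite F \<and> (\<forall>X\<in>F. \<forall>Y\<in>F. X \<subseteq> Y \<or> Y \<subseteq> X) \<and>
     (\<forall>X\<in>F. module.subspace s X \<and> X \<subseteq> V) \<and> {0} \<in> F \<and> V \<in> F"

text \<open>
Equivalently, for a linearly independent \<open>B\<close>, every subspace in \<open>F\<close> has a basis consisting of
elements of \<open>B\<close>.
\<close>

definition adapted :: "('k::field \<Rightarrow> 'v::ab_group_add \<Rightarrow> 'v) \<Rightarrow> 'v set \<Rightarrow> 'v set set \<Rightarrow> bool" where
  "adapted s B F \<longleftrightarrow> (\<forall>X\<in>F. X \<subseteq> module.span s (B \<inter> X))"

text \<open>
The flag induced on \<open>V\<close> by a flag \<open>F\<close> in \<open>W\<close>, for \<open>f: V \<rightarrow> W\<close> and \<open>g: W \<rightarrow> V\<close> that compose to zero.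
As \<open>F\<close> contains \<open>{0}\<close> and \<open>W\<close>, the kernel of \<open>f\<close> and the image of \<open>g\<close> are among its members.
\<close>

definition pullback :: "('v \<Rightarrow> 'v) \<Rightarrow> ('v \<Rightarrow> 'v) \<Rightarrow> 'v set \<Rightarrow> 'v set set \<Rightarrow> 'v set set" where
  "pullback f g V F = (\<lambda>X. g ` X) ` F \<union> (\<lambda>X. {v \<in> V. f v \<in> X}) ` F"

text \<open>
The map \<open>f\<close> induces a partial injection from \<open>B\<close> to \<open>C\<close>, where the value \<open>0\<close> stands for undefined.
\<close>

definition matching :: "('v::zero \<Rightarrow> 'v) \<Rightarrow> 'v set \<Rightarrow> 'v set \<Rightarrow> bool" where
  "matching f B C \<longleftrightarrow> f ` B \<subseteq> insert 0 C \<and> inj_on f {b \<in> B. f b \<noteq> 0}"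

lemma flagD:
  assumes "flag s V F"
  shows flag_finite: "finite F"
    and flag_chain: "\<And>X Y. X \<in> F \<Longrightarrow> Y \<in> F \<Longrightarrow> X \<subseteq> Y \<or> Y \<subseteq> X"
    and flag_subspace: "\<And>X. X \<in> F \<Longrightarrow> module.subspace s X"
    and flag_subset: "\<And>X. X \<in> F \<Longrightarrow> X \<subseteq> V"
    and flag_zero: "{0} \<in> F" and flag_top: "V \<in> F"
  using assms unfolding flag_def by blast+

lemma adaptedD: "adapted s B F \<Longrightarrow> X \<in> F \<Longrightarrow> X \<subseteq> module.span s (B \<inter> X)"
  by (simp add: adapted_def)

lemma image_in_pullback: "X \<in> F \<Longrightarrow> g ` X \<in> pullback f g V F"
  by (simp add: pullback_def)

lemma preimage_in_pullback: "X \<in> F \<Longrightarrow> {v \<in> V. f v \<in> X} \<in> pullback f g V F"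
  by (simp add: pullback_def)

context vector_space
begin

lemma trivial_span_Int:
  assumes "independent (A \<union> B)" "A \<inter> B = {}" shows "span A \<inter> span B = {0}"
proof -
  have "x = 0" if x: "x \<in> span A" "x \<in> span B" for x
  proof -
    have "representation (A \<union> B) x = representation A x"
      by (rule representation_extend) (use x assms(1) in auto)
    moreover have "representation (A \<union> B) x = representation B x"
      by (rule representation_extend) (use x assms(1) in auto)
    ultimately have "{b. representation (A \<union> B) x b \<noteq> 0} \<subseteq> A \<inter> B"
      using representation_ne_zero[of A x] representation_ne_zero[of B x] by auto
    then have "{b. representation (A \<union> B) x b \<noteq> 0} = {}" using assms(2) by blast
    moreover have "x \<in> span (A \<union> B)" using x span_mono[of A "A \<union> B"] by auto
    ultimately show ?thesis
      using sum_nonzero_representation_eq[OF assms(1), of x] by (simp only: sum.empty)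
  qed
  then show ?thesis using span_zero by auto
qed

lemma independent_Un:
  assumes A: "independent A" and B: "independent B" and AB: "span A \<inter> span B = {0}"
  shows "independent (A \<union> B)"
proof -
  have *: "a \<notin> span (X \<union> Y - {a})"
    if X: "independent X" and Y: "independent Y" and XY: "span X \<inter> span Y = {0}" and a: "a \<in> X" for X Y a
  proof
    assume h: "a \<in> span (X \<union> Y - {a})"
    have "a \<noteq> 0" using X a dependent_zero by blast
    then have "a \<notin> Y" using XY a span_base by blast
    then have "X \<union> Y - {a} = (X - {a}) \<union> Y" by blast
    with h have "a \<in> span ((X - {a}) \<union> Y)" by (simp only:)
    then obtain x y where xy: "x \<in> span (X - {a})" "y \<in> span Y" "a = x + y"
      unfolding span_Un by blast
    have "x \<in> span X" using xy(1) span_mono[of "X - {a}" X] by blast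
    then have "y \<in> span X" using xy(3) span_diff[OF span_base[OF a], of x] by simp
    then have "y = 0" using xy(2) XY by blast
    then show False using xy X a dependent_def by auto
  qed
  have BA: "span B \<inter> span A = {0}" using AB by (simp only: Int_commute)
  show ?thesis
  proof
    assume "dependent (A \<union> B)"
    then obtain a where "a \<in> A \<union> B" "a \<in> span (A \<union> B - {a})" unfolding dependent_def by (elim bexE)
    then show False using *[OF A B AB, of a] *[OF B A BA, of a] by (simp only: Un_iff Un_commute) blast
  qed
qed

text \<open>
The step that completes a partial basis without spoiling any member of the chain. The condition
on \<open>span A\<close> says that \<open>A\<close> is adapted to the traces of the chain on \<open>span A\<close>. The largest member \<open>M\<close> is treated
last: what was found for the smaller members lies, apart from \<open>A\<close>, inside \<open>M\<close> and is completed to a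
basis \<open>E\<close> of \<open>M\<close>; the vectors of \<open>A\<close> outside \<open>M\<close> stay independent of \<open>E\<close> by the condition on \<open>span A\<close>.
\<close>

lemma extend_independent_to_adapted:
  assumes "finite F" and "\<And>X Y. X \<in> F \<Longrightarrow> Y \<in> F \<Longrightarrow> X \<subseteq> Y \<or> Y \<subseteq> X"
    and "\<And>X. X \<in> F \<Longrightarrow> subspace X"
    and "independent A" and "\<And>X. X \<in> F \<Longrightarrow> span A \<inter> X \<subseteq> span (A \<inter> X)"
  shows "\<exists>C. A \<subseteq> C \<and> C \<subseteq> A \<union> \<Union>F \<and> independent C \<and> adapted scale C F"
  using assms(1-3,5)
proof (induction F rule: finite_psubset_induct)
  case (psubset F)
  show ?case
  proof (cases "F = {}")
    case True
    then show ?thesis using assms(4) by (auto simp: adapted_def)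
  next
    case False
    then obtain M where M: "M \<in> F" "\<And>X. X \<in> F \<Longrightarrow> M \<subseteq> X \<Longrightarrow> M = X"
      using finite_has_maximal[OF psubset.hyps(1)] by blast
    have top: "X \<subseteq> M" if "X \<in> F" for X using psubset.prems(1)[OF that M(1)] M(2)[OF that] by blast
    have sM: "subspace M" using psubset.prems(2) M(1) by blast
    have "\<exists>C. A \<subseteq> C \<and> C \<subseteq> A \<union> \<Union>(F - {M}) \<and> independent C \<and> adapted scale C (F - {M})"
      using M(1) by (intro psubset.IH psubset.prems) auto
    then obtain C where C: "A \<subseteq> C" "C \<subseteq> A \<union> \<Union>(F - {M})" "independent C" "adapted scale C (F - {M})" by blast
    have "independent (C \<inter> M)" by (rule independent_mono[OF C(3)]) simp
    then obtain E where E: "C \<inter> M \<subseteq> E" "E \<subseteq> M" "independent E" "M \<subseteq> span E"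
      using maximal_independent_subset_extend[of "C \<inter> M" M] by (metis Int_lower2)
    have "x = 0" if "x \<in> span (A - M)" "x \<in> span E" for x
    proof -
      have "x \<in> M" using that(2) E(2) sM span_minimal[of E M] by (simp add: subset_iff)
      moreover have "x \<in> span A" using that(1) span_mono[of "A - M" A] by (simp add: subset_iff)
      ultimately have "x \<in> span (A \<inter> M)" using psubset.prems(3)[OF M(1)] by (simp add: subset_iff)
      moreover have "span (A - M) \<inter> span (A \<inter> M) = {0}"
      proof (rule trivial_span_Int)
        show "independent (A - M \<union> A \<inter> M)" by (rule independent_mono[OF assms(4)]) auto
      qed auto
      ultimately show ?thesis using that(1) by blast
    qed
    then have "span (A - M) \<inter> span E = {0}" using span_zero by (intro equalityI subsetI) simp_all
    then have ind: "independent (A - M \<union> E)"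
      by (intro independent_Un[OF independent_mono[OF assms(4)] E(3)]) auto
    have sup: "C \<subseteq> A - M \<union> E"
    proof
      fix x assume "x \<in> C"
      then show "x \<in> A - M \<union> E" using C(2) E(1) top by (cases "x \<in> M") auto
    qed
    have "X \<subseteq> span ((A - M \<union> E) \<inter> X)" if "X \<in> F" for X
    proof (cases "X = M")
      case True
      have "E \<subseteq> (A - M \<union> E) \<inter> M" using E(2) by simp
      then show ?thesis using E(4) span_mono True by (meson order_trans)
    next
      case False
      then have "X \<subseteq> span (C \<inter> X)" using that C(4) by (simp add: adapted_def)
      moreover have "C \<inter> X \<subseteq> (A - M \<union> E) \<inter> X" using sup by (rule Int_mono) simp
      ultimately show ?thesis using span_mono by (meson order_trans)
    qed
    then have "adapted scale (A - M \<union> E) F" by (simp add: adapted_def)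
    moreover have "A \<subseteq> A - M \<union> E" using sup C(1) by simp
    moreover have "A - M \<union> E \<subseteq> A \<union> \<Union>F" using E(2) M(1) by auto
    ultimately show ?thesis using ind by (intro exI[of _ "A - M \<union> E"] conjI)
  qed
qed

end

section \<open>Carrying an adapted basis across one pair of opposite arrows\<close>

context vector_space
begin

lemma flag_pullback:
  assumes f: "Vector_Spaces.linear scale scale f" and g: "Vector_Spaces.linear scale scale g"
    and V: "subspace V" and gW: "g ` W \<subseteq> V" "f ` V \<subseteq> W"
    and fg: "\<And>w. w \<in> W \<Longrightarrow> f (g w) = 0" and F: "flag scale W F"
  shows "flag scale V (pullback f g V F)"
proof -
  interpret f: Vector_Spaces.linear scale scale f by fact
  interpret g: Vector_Spaces.linear scale scale g by fact
  have zero: "0 \<in> X" if "X \<in> F" for X using flag_subspace[OF F that] by (rule subspace_0)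
  \<comment> \<open>An image lies below every preimage: this comparability is where the vanishing of the composite enters.\<close>
  have low: "g ` X \<subseteq> {v \<in> V. f v \<in> Y}" if XY: "X \<in> F" "Y \<in> F" for X Y
  proof
    fix v assume "v \<in> g ` X"
    then obtain w where "w \<in> W" "v = g w" using flag_subset[OF F XY(1)] by blast
    then show "v \<in> {v \<in> V. f v \<in> Y}" using gW(1) fg zero[OF XY(2)] by auto
  qed
  have chain: "g ` X \<subseteq> g ` Y \<or> g ` Y \<subseteq> g ` X"
    "{v \<in> V. f v \<in> X} \<subseteq> {v \<in> V. f v \<in> Y} \<or> {v \<in> V. f v \<in> Y} \<subseteq> {v \<in> V. f v \<in> X}"
    if "X \<in> F" "Y \<in> F" for X Y
  proof -
    have "X \<subseteq> Y \<or> Y \<subseteq> X" using flag_chain[OF F that] .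
    then show "g ` X \<subseteq> g ` Y \<or> g ` Y \<subseteq> g ` X"
      "{v \<in> V. f v \<in> X} \<subseteq> {v \<in> V. f v \<in> Y} \<or> {v \<in> V. f v \<in> Y} \<subseteq> {v \<in> V. f v \<in> X}"
      by blast+
  qed
  have "subspace (g ` X)" "subspace {v \<in> V. f v \<in> X}" if "X \<in> F" for X
  proof -
    have X: "subspace X" using flag_subspace[OF F that] .
    show "subspace (g ` X)" using X by (rule g.subspace_image)
    show "subspace {v \<in> V. f v \<in> X}"
      using V X by (auto simp: subspace_def f.add f.scale)
  qed
  moreover have "{0} \<in> pullback f g V F" 
    using image_in_pullback[OF flag_zero[OF F], of g f V] by simp
  moreover have "V \<in> pullback f g V F"
  proof -
    have "V = {v \<in> V. f v \<in> W}" using gW by blast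
    then show ?thesis using preimage_in_pullback[OF flag_top[OF F], of V f g] by simp
  qed
  moreover have "X \<subseteq> V" if "X \<in> pullback f g V F" for X
  proof -
    from that consider Y where "Y \<in> F" "X = g ` Y" | Y where "X = {v \<in> V. f v \<in> Y}"
      unfolding pullback_def by blast
    then show ?thesis
    proof cases
      case (1 Y)
      then have "X \<subseteq> g ` W" using flag_subset[OF F] by (simp add: image_mono)
      then show ?thesis using gW(1) by (rule subset_trans)
    qed blast
  qed
  moreover have "X \<subseteq> Y \<or> Y \<subseteq> X" if "X \<in> pullback f g V F" "Y \<in> pullback f g V F" for X Y
  proof -
    have cases: "(\<exists>X\<in>F. Z = g ` X) \<or> (\<exists>X\<in>F. Z = {v \<in> V. f v \<in> X})" if "Z \<in> pullback f g V F" for Z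
      using that by (simp add: pullback_def image_iff)
    show ?thesis
      using cases[OF that(1)] cases[OF that(2)]
      by (elim disjE bexE) (simp_all only: chain low disj_commute simp_thms)
  qed
  moreover have "finite (pullback f g V F)" using flag_finite[OF F] by (simp add: pullback_def)
  moreover have "subspace X" if "X \<in> pullback f g V F" for X
    using that \<open>\<And>X. X \<in> F \<Longrightarrow> subspace (g ` X)\<close> \<open>\<And>X. X \<in> F \<Longrightarrow> subspace {v \<in> V. f v \<in> X}\<close>
    unfolding pullback_def by blast
  ultimately show ?thesis unfolding flag_def by simp
qed

text \<open>
A preimage that lies as deep in the flag as possible: it is taken from the smallest member whose
image contains \<open>b\<close>.
\<close>

lemma exists_adapted_lift:
  assumes F: "flag scale W F" and b: "b \<in> g ` W"
  shows "\<exists>c\<in>W. g c = b \<and> (\<forall>X\<in>F. b \<in> g ` X \<longrightarrow> c \<in> X)"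
proof -
  let ?G = "{X \<in> F. b \<in> g ` X}"
  have "finite ?G" using flag_finite[OF F] by simp
  moreover have "?G \<noteq> {}" using flag_top[OF F] b by blast
  ultimately obtain M where M: "M \<in> ?G" "\<forall>X\<in>?G. X \<subseteq> M \<longrightarrow> M = X"
    by (elim bexE[OF finite_has_minimal])
  then obtain c where c: "c \<in> M" "g c = b" by blast
  have "c \<in> X" if "X \<in> F" "b \<in> g ` X" for X
  proof -
    have "M \<subseteq> X \<or> X \<subseteq> M" using flag_chain[OF F, of M X] M(1) that(1) by simp
    then show ?thesis using bspec[OF M(2), of X] that c(1) by auto
  qed
  moreover have "c \<in> W" using c(1) M(1) flag_subset[OF F, of M] by auto
  ultimately show ?thesis using c(2) by blast
qed

text \<open>
Let \<open>K\<close> be the kernel of \<open>g\<close> in \<open>W\<close>; it contains the image of \<open>f\<close>. The basis \<open>C\<close> of \<open>W\<close> consists of three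
parts: the nonzero images \<open>f b\<close>, vectors that complete them to an adapted basis of \<open>K\<close>, and for each
basis vector \<open>b\<close> in the image of \<open>g\<close> a preimage chosen deep in the flag. The first two parts are
killed by \<open>g\<close> and the third is mapped bijectively onto the part of \<open>B\<close> in the image of \<open>g\<close>, which gives
both matchings. The members of the pulled back flag serve as follows: the kernel of \<open>f\<close> makes the
nonzero images independent, the preimages of \<open>F\<close> make them adapted, and the images of \<open>F\<close> let the
chosen preimages account for each member of \<open>F\<close> modulo \<open>K\<close>.
\<close>

lemma transport_adapted_basis:
  assumes f: "Vector_Spaces.linear scale scale f" and g: "Vector_Spaces.linear scale scale g"
    and W: "subspace W" and maps: "f ` V \<subseteq> W" "g ` W \<subseteq> V"
    and gf: "\<And>v. v \<in> V \<Longrightarrow> g (f v) = 0"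
    and F: "flag scale W F"
    and B: "independent B" "span B = V" "adapted scale B (pullback f g V F)"
  shows "\<exists>C. independent C \<and> span C = W \<and> adapted scale C F \<and> matching f B C \<and> matching g C B"
proof -
  interpret f: Vector_Spaces.linear scale scale f by fact
  interpret g: Vector_Spaces.linear scale scale g by fact
  have sub: "subspace X" "X \<subseteq> W" if "X \<in> F" for X using flag_subspace[OF F that] flag_subset[OF F that] .
  have BV: "B \<subseteq> V" using B(2) span_superset by blast
  define K where "K = {w \<in> W. g w = 0}"
  have sK: "subspace K" using W by (auto simp: K_def subspace_def g.add g.scale)

  \<comment> \<open>The nonzero images of basis vectors form an adapted basis of the image of \<open>f\<close>.\<close>
  define B1 where "B1 = {b \<in> B. f b \<noteq> 0}"
  define A where "A = f ` B1"
  have injf: "inj_on f (span B1)"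
    unfolding f.inj_on_iff_eq_0[OF subspace_span]
  proof (intro ballI impI)
    fix x assume x: "x \<in> span B1" "f x = 0"
    have "{v \<in> V. f v \<in> {0}} \<subseteq> span (B \<inter> {v \<in> V. f v \<in> {0}})"
      by (rule adaptedD[OF B(3) preimage_in_pullback[OF flag_zero[OF F]]])
    moreover have "x \<in> V" using x(1) B(2) span_mono[of B1 B] by (auto simp: B1_def)
    ultimately have "x \<in> span (B \<inter> {v \<in> V. f v \<in> {0}})" using x(2) by blast
    moreover have "span B1 \<inter> span (B \<inter> {v \<in> V. f v \<in> {0}}) = {0}"
    proof (rule trivial_span_Int)
      show "independent (B1 \<union> B \<inter> {v \<in> V. f v \<in> {0}})"
        by (rule independent_mono[OF B(1)]) (auto simp: B1_def)
    qed (auto simp: B1_def)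
    ultimately show "x = 0" using x(1) by blast
  qed
  have iA: "independent A"
    unfolding A_def
    by (intro f.independent_injective_image injf independent_mono[OF B(1)]) (auto simp: B1_def)
  have AK: "A \<subseteq> K" using BV maps gf by (auto simp: A_def B1_def K_def)
  have adA: "span A \<inter> X \<subseteq> span (A \<inter> X)" if X: "X \<in> F" for X
  proof
    fix x assume x: "x \<in> span A \<inter> X"
    have "span A \<subseteq> f ` V"
      using span_mono[of A "f ` B"] by (auto simp: A_def B1_def f.span_image B(2))
    then obtain v where v: "v \<in> V" "x = f v" using x by blast
    let ?P = "{v \<in> V. f v \<in> X}"
    have "?P \<subseteq> span (B \<inter> ?P)" by (rule adaptedD[OF B(3) preimage_in_pullback[OF X]])
    then have "v \<in> span (B \<inter> ?P)" using v x by blast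
    then have "x \<in> span (f ` (B \<inter> ?P))" using v by (simp add: f.span_image)
    also have "\<dots> \<subseteq> span (insert 0 (A \<inter> X))" by (rule span_mono) (auto simp: A_def B1_def)
    finally show "x \<in> span (A \<inter> X)" by simp
  qed

  \<comment> \<open>Completion to an adapted basis of the kernel of \<open>g\<close>.\<close>
  have "\<exists>C. A \<subseteq> C \<and> C \<subseteq> A \<union> \<Union>((\<lambda>X. X \<inter> K) ` F) \<and> independent C \<and> adapted scale C ((\<lambda>X. X \<inter> K) ` F)"
  proof (rule extend_independent_to_adapted)
    show "span A \<inter> X \<subseteq> span (A \<inter> X)" if "X \<in> (\<lambda>X. X \<inter> K) ` F" for X
    proof -
      from that obtain Y where Y: "Y \<in> F" "X = Y \<inter> K" by blast
      then have "A \<inter> X = A \<inter> Y" using AK by blast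
      then show ?thesis using adA[OF Y(1)] Y(2) by auto
    qed
    show "X \<subseteq> Y \<or> Y \<subseteq> X" if "X \<in> (\<lambda>X. X \<inter> K) ` F" "Y \<in> (\<lambda>X. X \<inter> K) ` F" for X Y
      using that flag_chain[OF F] by (elim imageE) fast
    show "subspace X" if "X \<in> (\<lambda>X. X \<inter> K) ` F" for X
      using that sub(1) sK by (auto intro: subspace_inter)
  qed (use flag_finite[OF F] iA in simp_all)
  then obtain C where C: "A \<subseteq> C" "C \<subseteq> A \<union> \<Union>((\<lambda>X. X \<inter> K) ` F)" "independent C"
    "adapted scale C ((\<lambda>X. X \<inter> K) ` F)" by (elim exE conjE)
  have CK: "C \<subseteq> K" using C(2) AK by blast

  have "\<forall>b\<in>g ` W. \<exists>c. c \<in> W \<and> g c = b \<and> (\<forall>X\<in>F. b \<in> g ` X \<longrightarrow> c \<in> X)"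
    using exists_adapted_lift[OF F, of _ g] by (simp only: Bex_def) blast
  then obtain c where
    c: "\<And>b. b \<in> g ` W \<Longrightarrow> c b \<in> W \<and> g (c b) = b \<and> (\<forall>X\<in>F. b \<in> g ` X \<longrightarrow> c b \<in> X)"
    by (elim bchoice[THEN exE]) (simp only: Ball_def, blast)
  define D where "D = c ` (B \<inter> g ` W)"
  have DW: "D \<subseteq> W" using c by (auto simp: D_def)
  have gD: "g ` D = B \<inter> g ` W"
  proof -
    have "(\<lambda>b. g (c b)) ` (B \<inter> g ` W) = (\<lambda>b. b) ` (B \<inter> g ` W)" using c by (intro image_cong) auto
    then show ?thesis by (simp add: D_def image_image)
  qed
  have injD: "inj_on g D" using c by (auto simp: D_def inj_on_def)
  have igD: "independent (g ` D)" unfolding gD by (rule independent_mono[OF B(1)]) simp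
  have injsD: "inj_on g (span D)" using g.inj_on_span_independent_image[OF igD injD] .
  have iD: "independent D"
    unfolding dependent_def
  proof
    assume "\<exists>d\<in>D. d \<in> span (D - {d})"
    then obtain d where d: "d \<in> D" "d \<in> span (D - {d})" by (elim bexE)
    have "g d \<in> span (g ` (D - {d}))" using d(2) by (simp add: g.span_image)
    also have "g ` (D - {d}) = g ` D - {g d}" using inj_on_image_set_diff[OF injD, of D "{d}"] d(1) by simp
    finally show False using igD d(1) by (auto simp: dependent_def)
  qed

  have iCD: "independent (C \<union> D)"
  proof (rule independent_Un[OF C(3) iD])
    have "span C \<subseteq> K" using CK sK by (simp add: span_minimal)
    moreover have "x = 0" if "x \<in> span D" "g x = 0" for x
      using injsD that g.inj_on_iff_eq_0[OF subspace_span] by blast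
    ultimately show "span C \<inter> span D = {0}" using span_zero by (auto simp: K_def)
  qed
  have ad: "adapted scale (C \<union> D) F"
    unfolding adapted_def
  proof (intro ballI subsetI)
    fix X x assume X: "X \<in> F" and x: "x \<in> X"
    \<comment> \<open>Subtracting a combination of chosen preimages moves \<open>x\<close> into the kernel of \<open>g\<close>.\<close>
    have "g x \<in> span (B \<inter> g ` X)" using adaptedD[OF B(3) image_in_pullback[OF X]] x by blast
    also have "\<dots> \<subseteq> span (g ` (D \<inter> X))"
    proof (intro span_mono subsetI)
      fix b assume "b \<in> B \<inter> g ` X"
      then have "b \<in> B \<inter> g ` W" "b \<in> g ` X" using sub(2)[OF X] by auto
      then have "c b \<in> D \<inter> X" "g (c b) = b" using c X by (auto simp: D_def)
      then show "b \<in> g ` (D \<inter> X)" by (metis imageI)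
    qed
    also have "\<dots> = g ` span (D \<inter> X)" by (rule g.span_image)
    finally obtain d where d: "d \<in> span (D \<inter> X)" "g x = g d" by blast
    have dX: "d \<in> X" using d(1) sub(1)[OF X] span_minimal[of "D \<inter> X" X] by blast
    have "x - d \<in> X \<inter> K"
      using x dX d(2) sub[OF X] subspace_diff by (auto simp: K_def g.diff)
    then have "x - d \<in> span (C \<inter> (X \<inter> K))" using adaptedD[OF C(4), of "X \<inter> K"] X by blast
    then have "x - d \<in> span ((C \<union> D) \<inter> X)" using span_mono[of "C \<inter> (X \<inter> K)" "(C \<union> D) \<inter> X"] by blast
    moreover have "d \<in> span ((C \<union> D) \<inter> X)" using d(1) span_mono[of "D \<inter> X" "(C \<union> D) \<inter> X"] by blast
    ultimately show "x \<in> span ((C \<union> D) \<inter> X)" using span_add by fastforce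
  qed
  have "W \<subseteq> span (C \<union> D)"
    using adaptedD[OF ad flag_top[OF F]] span_mono[of "(C \<union> D) \<inter> W" "C \<union> D"] by blast
  moreover have "span (C \<union> D) \<subseteq> W" using CK DW W by (intro span_minimal) (auto simp: K_def)
  moreover have "matching f B (C \<union> D)"
  proof -
    have "inj_on f {b \<in> B. f b \<noteq> 0}"
      using inj_on_subset[OF injf span_superset] by (simp only: B1_def)
    then show ?thesis using C(1) by (auto simp: matching_def A_def B1_def)
  qed
  moreover have "matching g (C \<union> D) B"
  proof -
    have "{x \<in> C \<union> D. g x \<noteq> 0} \<subseteq> D" using CK by (auto simp: K_def)
    then have "inj_on g {x \<in> C \<union> D. g x \<noteq> 0}" using injD inj_on_subset by blast
    moreover have "g ` (C \<union> D) \<subseteq> insert 0 B" using CK gD by (auto simp: K_def)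
    ultimately show ?thesis by (simp add: matching_def)
  qed
  ultimately show ?thesis using iCD ad by blast
qed

end

section \<open>String bases of representations\<close>

definition string_basis ::
  "('k::field \<Rightarrow> 'v::ab_group_add \<Rightarrow> 'v) \<Rightarrow> nat \<Rightarrow> (nat, AA_arrow, 'v) rep \<Rightarrow> (nat \<Rightarrow> 'v set) \<Rightarrow> bool" where
  "string_basis s n R B \<longleftrightarrow>
     (\<forall>k\<in>{1..n}. \<not> module.dependent s (B k) \<and> module.span s (B k) = space R k) \<and>
     (\<forall>k\<in>{1..<n}. matching (act R (Alpha k)) (B k) (B (Suc k)) \<and>
        matching (act R (Beta k)) (B (Suc k)) (B k))"

lemma representation_AA_iff:
  "Defs.representation s (AA n) R \<longleftrightarrow>
     (\<forall>k\<in>{1..n}. module.subspace s (space R k) \<and>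
        (\<exists>B. finite B \<and> module.span s B = space R k)) \<and>
     (\<forall>k\<in>{1..<n}. linear_on s s (space R k) (space R (Suc k)) (act R (Alpha k)) \<and>
        linear_on s s (space R (Suc k)) (space R k) (act R (Beta k)) \<and>
        (\<forall>x\<in>space R k. act R (Beta k) (act R (Alpha k) x) = 0) \<and>
        (\<forall>x\<in>space R (Suc k). act R (Alpha k) (act R (Beta k) x) = 0))"
  by (simp add: Defs.representation_def AA_def ball_Un ball_conj_distrib conj_ac)

lemma matching_cong:
  assumes "\<And>x. x \<in> B \<Longrightarrow> f x = g x"
  shows "matching f B C \<longleftrightarrow> matching g B C"
proof -
  have "f ` B = g ` B" using assms by (simp cong: image_cong)
  moreover have "{b \<in> B. f b \<noteq> 0} = {b \<in> B. g b \<noteq> 0}" using assms by auto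
  moreover have "inj_on f {b \<in> B. g b \<noteq> 0} \<longleftrightarrow> inj_on g {b \<in> B. g b \<noteq> 0}"
    using assms by (intro inj_on_cong) simp
  ultimately show ?thesis by (simp add: matching_def)
qed

context vector_space
begin

text \<open>
This gives access to the theory of total linear maps for the maps of a representation, which are
only meaningful on the subspaces at the vertices.
\<close>

lemma linear_on_extend:
  assumes V: "subspace V" and f: "linear_on scale scale V W f"
  shows "\<exists>g. Vector_Spaces.linear scale scale g \<and> (\<forall>x\<in>V. g x = f x)"
proof -
  interpret vp: vector_space_pair scale scale by unfold_locales
  obtain B where B: "B \<subseteq> V" "independent B" "V \<subseteq> span B"
    using maximal_independent_subset[of V] by metis
  obtain g where g: "Vector_Spaces.linear scale scale g" "\<forall>x\<in>B. g x = f x"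
    using vp.linear_independent_extend[OF B(2), of f] by blast
  interpret g: Vector_Spaces.linear scale scale g by fact
  have add: "f (x + y) = f x + f y" if "x \<in> V" "y \<in> V" for x y
    using f that by (simp add: linear_on_def)
  have scl: "f (scale c x) = scale c (f x)" if "x \<in> V" for c x
    using f that by (simp add: linear_on_def)
  have "f 0 = 0" using scl[OF subspace_0[OF V], of 0] by simp
  then have "subspace {x \<in> V. g x = f x}"
    using V by (simp add: subspace_def add scl g.add g.scale)
  moreover have "B \<subseteq> {x \<in> V. g x = f x}" using B(1) g(2) by auto
  ultimately have "span B \<subseteq> {x \<in> V. g x = f x}" by (rule span_minimal[rotated])
  then have "\<forall>x\<in>V. g x = f x" using B(3) by auto
  then show ?thesis using g(1) by blast
qed

lemma linear_on_image_span:
  assumes "subspace V" "linear_on scale scale V W f" "X \<subseteq> V" "f ` X \<subseteq> span Y"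
  shows "f ` span X \<subseteq> span Y"
proof -
  obtain g where g: "Vector_Spaces.linear scale scale g" "\<forall>x\<in>V. g x = f x"
    using linear_on_extend[OF assms(1,2)] by blast
  interpret g: Vector_Spaces.linear scale scale g by fact
  have sub: "span X \<subseteq> V" using assms(1,3) by (simp add: span_minimal)
  have "f ` span X = g ` span X" using g(2) sub by (intro image_cong) auto
  also have "\<dots> = span (g ` X)" by (rule g.span_image[symmetric])
  also have "g ` X = f ` X" using g(2) assms(3) by (intro image_cong) auto
  also have "span (f ` X) \<subseteq> span Y" using assms(4) by (simp add: span_minimal)
  finally show ?thesis .
qed

text \<open>
The flag is what makes the induction work: the step for \<open>n + 1\<close> uses the hypothesis for the flag that
\<open>F\<close> and the last two arrows induce at the vertex \<open>n\<close>.
\<close>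

lemma exists_string_basis:
  assumes "n \<ge> 1" "Defs.representation scale (AA n) R" "flag scale (space R n) F"
  shows "\<exists>B. string_basis scale n R B \<and> adapted scale (B n) F"
  using assms
proof (induction n arbitrary: F rule: nat_induct_at_least)
  case base
  note F = base.prems(2)
  have "\<exists>C. {} \<subseteq> C \<and> C \<subseteq> {} \<union> \<Union>F \<and> independent C \<and> adapted scale C F"
    using F unfolding flag_def
    by (intro extend_independent_to_adapted) (simp_all add: independent_empty)
  then obtain C where C: "C \<subseteq> \<Union>F" "independent C" "adapted scale C F" by auto
  have sub: "subspace (space R 1)" "\<Union>F \<subseteq> space R 1" using F by (simp_all add: flag_def Sup_le_iff)
  have "space R 1 \<subseteq> span (C \<inter> space R 1)" using F C(3) by (simp add: flag_def adapted_def)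
  also have "\<dots> \<subseteq> span C" by (rule span_mono) simp
  finally have "space R 1 \<subseteq> span C" .
  moreover have "span C \<subseteq> space R 1" using C(1) sub by (intro span_minimal) auto
  ultimately show ?case
    using C by (intro exI[of _ "\<lambda>_. C"]) (simp add: string_basis_def)
next
  case (Suc n)
  note F = Suc.prems(2)
  have n: "n \<in> {1..<Suc n}" using Suc.hyps by simp
  have rep: "Defs.representation scale (AA n) R"
    using Suc.prems(1) unfolding representation_AA_iff by simp
  let ?V = "space R n" and ?W = "space R (Suc n)" and ?f = "act R (Alpha n)" and ?g = "act R (Beta n)"
  have V: "subspace ?V" and W: "subspace ?W"
    using Suc.prems(1) n unfolding representation_AA_iff by simp_all
  have lf: "linear_on scale scale ?V ?W ?f" and lg: "linear_on scale scale ?W ?V ?g"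
    and gf: "\<And>x. x \<in> ?V \<Longrightarrow> ?g (?f x) = 0" and fg: "\<And>x. x \<in> ?W \<Longrightarrow> ?f (?g x) = 0"
    using Suc.prems(1) n unfolding representation_AA_iff by blast+
  obtain f where f: "Vector_Spaces.linear scale scale f" "\<And>x. x \<in> ?V \<Longrightarrow> f x = ?f x"
    using linear_on_extend[OF V lf] by blast
  obtain g where g: "Vector_Spaces.linear scale scale g" "\<And>x. x \<in> ?W \<Longrightarrow> g x = ?g x"
    using linear_on_extend[OF W lg] by blast
  have maps: "f ` ?V \<subseteq> ?W" "g ` ?W \<subseteq> ?V"
    using lf lg f(2) g(2) by (auto simp: linear_on_def)
  have gf': "\<And>x. x \<in> ?V \<Longrightarrow> g (f x) = 0" and fg': "\<And>x. x \<in> ?W \<Longrightarrow> f (g x) = 0"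
    using f(2) g(2) gf fg maps by (simp_all add: image_subset_iff)
  have "flag scale ?V (pullback f g ?V F)"
    using flag_pullback[OF f(1) g(1) V maps(2,1) fg' F] .
  then obtain B where B: "string_basis scale n R B" "adapted scale (B n) (pullback f g ?V F)"
    using Suc.IH[OF rep] by blast
  have Bn: "independent (B n)" "span (B n) = ?V"
    using B(1) Suc.hyps by (simp_all add: string_basis_def)
  obtain C where C: "independent C" "span C = ?W" "adapted scale C F"
    "matching f (B n) C" "matching g C (B n)"
    using transport_adapted_basis[OF f(1) g(1) W maps gf' F Bn B(2)] by blast
  have "matching ?f (B n) C"
    using C(4) matching_cong[of "B n" f ?f C] f(2) span_superset[of "B n"] Bn(2) by blast
  moreover have "matching ?g C (B n)"
    using C(5) matching_cong[of C g ?g "B n"] g(2) span_superset[of C] C(2) by blast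
  moreover have "k = Suc n \<or> k \<in> {1..n}" if "k \<in> {1..Suc n}" for k using that by auto
  moreover have "k = n \<or> k \<in> {1..<n}" if "k \<in> {1..<Suc n}" for k using that by auto
  ultimately have "string_basis scale (Suc n) R (B(Suc n := C))"
    using B(1) C(1,2) unfolding string_basis_def
    by (metis atLeastAtMost_iff atLeastLessThan_iff fun_upd_apply less_irrefl_nat nat.inject not_less_eq_eq)
  then show ?case using C(3) by (intro exI[of _ "B(Suc n := C)"] conjI) (simp_all only: fun_upd_same)
qed

end

section \<open>An indecomposable representation has a single string\<close>

definition edge :: "(nat, AA_arrow, 'v) rep \<Rightarrow> (nat \<Rightarrow> 'v set) \<Rightarrow> nat \<Rightarrow> 'v \<Rightarrow> 'v \<Rightarrow> bool" where
  "edge R B k b c \<longleftrightarrow> b \<in> B k \<and> c \<in> B (Suc k) \<and>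
     (act R (Alpha k) b = c \<or> act R (Beta k) c = b)"

text \<open>
The points reached from the basis vector \<open>a\<close> at the vertex \<open>i\<close> by following edges towards larger
vertices. When nothing lies below the vertex \<open>i\<close>, this is the whole connected component of \<open>a\<close>.
\<close>

inductive strand :: "(nat, AA_arrow, 'v) rep \<Rightarrow> (nat \<Rightarrow> 'v set) \<Rightarrow> nat \<Rightarrow> 'v \<Rightarrow> nat \<Rightarrow> 'v \<Rightarrow> bool"
  for R B i a where
  start: "strand R B i a i a"
| step: "strand R B i a k b \<Longrightarrow> edge R B k b c \<Longrightarrow> strand R B i a (Suc k) c"

lemma strand_ge: "strand R B i a k b \<Longrightarrow> i \<le> k"
  by (induction rule: strand.induct) simp_all

lemma strand_in_basis: "strand R B i a k b \<Longrightarrow> a \<in> B i \<Longrightarrow> b \<in> B k"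
  by (induction rule: strand.induct) (simp_all add: edge_def)

lemma strand_Suc_cases:
  assumes "strand R B i a (Suc k) c" "Suc k \<noteq> i"
  obtains b where "strand R B i a k b" "edge R B k b c"
  using assms by (cases rule: strand.cases) auto

context vector_space
begin

lemma zero_notin_string_basis:
  assumes "string_basis scale n R B" "k \<in> {1..n}"
  shows "0 \<notin> B k"
  using assms dependent_zero[of "B k"] by (auto simp: string_basis_def)

lemma basis_in_space:
  assumes "string_basis scale n R B" "k \<in> {1..n}" "b \<in> B k"
  shows "b \<in> space R k"
  using assms span_base[of b "B k"] by (auto simp: string_basis_def)

lemma two_cycle_on_basis:
  assumes "Defs.representation scale (AA n) R" "string_basis scale n R B" "k \<in> {1..<n}"
  shows "b \<in> B k \<Longrightarrow> act R (Beta k) (act R (Alpha k) b) = 0"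
    and "c \<in> B (Suc k) \<Longrightarrow> act R (Alpha k) (act R (Beta k) c) = 0"
proof -
  have "k \<in> {1..n}" "Suc k \<in> {1..n}" using assms(3) by auto
  then show "b \<in> B k \<Longrightarrow> act R (Beta k) (act R (Alpha k) b) = 0"
    and "c \<in> B (Suc k) \<Longrightarrow> act R (Alpha k) (act R (Beta k) c) = 0"
    using assms(1,3) basis_in_space[OF assms(2)] by (simp_all add: representation_AA_iff)
qed

text \<open>
An edge is realised by exactly one of the two arrows. If two edges share an end and are realised by
the same arrow, they agree because the arrow is injective on the basis vectors that it does not
kill; if they are realised by opposite arrows, the common end contradicts the vanishing of the
2-cycle.
\<close>

lemma edge_unique:
  assumes R: "Defs.representation scale (AA n) R" and B: "string_basis scale n R B" and k: "k \<in> {1..<n}"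
  shows edge_unique_up: "edge R B k b c \<Longrightarrow> edge R B k b c' \<Longrightarrow> c = c'"
    and edge_unique_down: "edge R B k b c \<Longrightarrow> edge R B k b' c \<Longrightarrow> b = b'"
proof -
  have nz: "0 \<notin> B k" "0 \<notin> B (Suc k)" using zero_notin_string_basis[OF B] k by simp_all
  have injA: "inj_on (act R (Alpha k)) {b \<in> B k. act R (Alpha k) b \<noteq> 0}"
    and injB: "inj_on (act R (Beta k)) {c \<in> B (Suc k). act R (Beta k) c \<noteq> 0}"
    using B k by (simp_all add: string_basis_def matching_def)
  note cyc = two_cycle_on_basis[OF R B k]
  {
    assume e: "edge R B k b c" "edge R B k b c'"
    then have m: "b \<in> B k" "c \<in> B (Suc k)" "c' \<in> B (Suc k)" by (simp_all add: edge_def)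
    have "act R (Alpha k) b = c \<or> act R (Beta k) c = b" "act R (Alpha k) b = c' \<or> act R (Beta k) c' = b"
      using e by (simp_all add: edge_def)
    then consider "act R (Alpha k) b = c" "act R (Alpha k) b = c'"
      | "act R (Alpha k) b = c" "act R (Beta k) c' = b"
      | "act R (Beta k) c = b" "act R (Alpha k) b = c'"
      | "act R (Beta k) c = b" "act R (Beta k) c' = b" by blast
    then show "c = c'"
    proof cases
      case 4
      moreover have "b \<noteq> 0" using m(1) nz(1) by auto
      ultimately show ?thesis using inj_onD[OF injB, of c c'] m by simp
    qed (use cyc m nz in auto)
  }
  {
    assume e: "edge R B k b c" "edge R B k b' c"
    then have m: "b \<in> B k" "b' \<in> B k" "c \<in> B (Suc k)" by (simp_all add: edge_def)
    have "act R (Alpha k) b = c \<or> act R (Beta k) c = b" "act R (Alpha k) b' = c \<or> act R (Beta k) c = b'"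
      using e by (simp_all add: edge_def)
    then consider "act R (Alpha k) b = c" "act R (Alpha k) b' = c"
      | "act R (Alpha k) b = c" "act R (Beta k) c = b'"
      | "act R (Beta k) c = b" "act R (Alpha k) b' = c"
      | "act R (Beta k) c = b" "act R (Beta k) c = b'" by blast
    then show "b = b'"
    proof cases
      case 1
      moreover have "c \<noteq> 0" using m(3) nz(2) by auto
      ultimately show ?thesis using inj_onD[OF injA, of b b'] m by simp
    qed (use cyc m nz in auto)
  }
qed

lemma strand_unique:
  assumes R: "Defs.representation scale (AA n) R" and B: "string_basis scale n R B" and i: "1 \<le> i"
  shows "strand R B i a k b \<Longrightarrow> k \<le> n \<Longrightarrow> strand R B i a k b' \<Longrightarrow> b = b'"
proof (induction arbitrary: b' rule: strand.induct)
  case start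
  from start.prems(2) show ?case by (cases rule: strand.cases) (auto dest: strand_ge)
next
  case (step k b c)
  have ik: "i \<le> k" using step.hyps(1) by (rule strand_ge)
  then obtain b1 where b1: "strand R B i a k b1" "edge R B k b1 b'"
    using strand_Suc_cases[OF step.prems(2)] by auto
  then have "b1 = b" using step.IH[of b1] step.prems(1) by simp
  then show ?case using edge_unique_up[OF R B, of k b c b'] step.hyps(2) b1(2) ik i step.prems(1) by simp
qed

text \<open>
A strand that starts at the lowest occupied vertex \<open>i\<close> cannot be entered from outside: the only edge
that leads down from one of its points is the one by which that point was reached, and at \<open>i\<close>
there is no edge that leads down.
\<close>

lemma strand_edge_iff:
  assumes R: "Defs.representation scale (AA n) R" and B: "string_basis scale n R B"
    and i: "\<And>k. 1 \<le> k \<Longrightarrow> k < i \<Longrightarrow> B k = {}"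
    and k: "k \<in> {1..<n}" and e: "edge R B k b c"
  shows "strand R B i a k b \<longleftrightarrow> strand R B i a (Suc k) c"
proof
  assume "strand R B i a (Suc k) c"
  moreover have "Suc k \<noteq> i" using i[of k] k e by (auto simp: edge_def)
  ultimately obtain b' where b': "strand R B i a k b'" "edge R B k b' c"
    by (rule strand_Suc_cases)
  then have "b = b'" using edge_unique_down[OF R B k e] by blast
  then show "strand R B i a k b" using b'(1) by simp
qed (rule strand.step[OF _ e])

lemma subrepresentation_span:
  assumes R: "Defs.representation scale (AA n) R"
    and X: "\<And>k. k \<in> {1..n} \<Longrightarrow> X k \<subseteq> space R k"
    and Alpha: "\<And>k. k \<in> {1..<n} \<Longrightarrow> act R (Alpha k) ` X k \<subseteq> insert 0 (X (Suc k))"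
    and Beta: "\<And>k. k \<in> {1..<n} \<Longrightarrow> act R (Beta k) ` X (Suc k) \<subseteq> insert 0 (X k)"
  shows "subrepresentation scale (AA n) R (\<lambda>k. span (X k))"
proof -
  have ins: "insert 0 Y \<subseteq> span Y" for Y using span_superset[of Y] span_zero[of Y] by simp
  have sub: "subspace (space R k)" if "k \<in> {1..n}" for k
    using R that by (simp add: representation_AA_iff)
  have lin: "linear_on scale scale (space R k) (space R (Suc k)) (act R (Alpha k))"
    "linear_on scale scale (space R (Suc k)) (space R k) (act R (Beta k))" if "k \<in> {1..<n}" for k
    using R that by (simp_all add: representation_AA_iff)
  have "act R (Alpha k) ` span (X k) \<subseteq> span (X (Suc k))" if k: "k \<in> {1..<n}" for k
    using k by (intro linear_on_image_span[OF sub lin(1)[OF k] X order_trans[OF Alpha ins]]) simp_all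
  moreover have "act R (Beta k) ` span (X (Suc k)) \<subseteq> span (X k)" if k: "k \<in> {1..<n}" for k
    using k by (intro linear_on_image_span[OF sub lin(2)[OF k] X order_trans[OF Beta ins]]) simp_all
  moreover have "span (X k) \<subseteq> space R k" if "k \<in> {1..n}" for k
    using span_minimal[OF X sub] that by simp
  ultimately show ?thesis by (auto simp: subrepresentation_def AA_def image_subset_iff)
qed

text \<open>
No edge joins the strand to the rest of the basis, so both span subrepresentations.
\<close>

lemma strand_complement_closed:
  assumes R: "Defs.representation scale (AA n) R" and B: "string_basis scale n R B"
    and i: "\<And>k. 1 \<le> k \<Longrightarrow> k < i \<Longrightarrow> B k = {}" and a: "a \<in> B i" "i \<in> {1..n}"
  defines "S \<equiv> \<lambda>k. {b. strand R B i a k b}"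
  shows "subrepresentation scale (AA n) R (\<lambda>k. span (S k))"
    and "subrepresentation scale (AA n) R (\<lambda>k. span (B k - S k))"
proof -
  have SB: "S k \<subseteq> B k" for k using strand_in_basis[of R B i a k] a(1) by (auto simp: S_def)
  have BR: "B k \<subseteq> space R k" if "k \<in> {1..n}" for k using basis_in_space[OF B that] by blast
  have Alpha: "act R (Alpha k) b \<in> insert 0 {c \<in> B (Suc k). c \<in> S (Suc k) \<longleftrightarrow> b \<in> S k}"
    if k: "k \<in> {1..<n}" and b: "b \<in> B k" for k b
  proof (cases "act R (Alpha k) b = 0")
    case False
    moreover have "act R (Alpha k) ` B k \<subseteq> insert 0 (B (Suc k))"
      using B k by (simp add: string_basis_def matching_def)
    then have "act R (Alpha k) b \<in> insert 0 (B (Suc k))" using b by blast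
    ultimately have e: "edge R B k b (act R (Alpha k) b)" using b by (simp add: edge_def)
    then show ?thesis using strand_edge_iff[OF R B i k e, where a = a] by (auto simp: S_def edge_def)
  qed simp
  have Beta: "act R (Beta k) c \<in> insert 0 {b \<in> B k. b \<in> S k \<longleftrightarrow> c \<in> S (Suc k)}"
    if k: "k \<in> {1..<n}" and c: "c \<in> B (Suc k)" for k c
  proof (cases "act R (Beta k) c = 0")
    case False
    moreover have "act R (Beta k) ` B (Suc k) \<subseteq> insert 0 (B k)"
      using B k by (simp add: string_basis_def matching_def)
    then have "act R (Beta k) c \<in> insert 0 (B k)" using c by blast
    ultimately have e: "edge R B k (act R (Beta k) c) c" using c by (simp add: edge_def)
    then show ?thesis using strand_edge_iff[OF R B i k e, where a = a] by (auto simp: S_def edge_def)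
  qed simp
  show "subrepresentation scale (AA n) R (\<lambda>k. span (S k))"
  proof (rule subrepresentation_span[OF R])
    show "S k \<subseteq> space R k" if "k \<in> {1..n}" for k using SB BR[OF that] by blast
    show "act R (Alpha k) ` S k \<subseteq> insert 0 (S (Suc k))" if "k \<in> {1..<n}" for k
      using Alpha[OF that] SB[of k] by blast
    show "act R (Beta k) ` S (Suc k) \<subseteq> insert 0 (S k)" if "k \<in> {1..<n}" for k
      using Beta[OF that] SB[of "Suc k"] by blast
  qed
  show "subrepresentation scale (AA n) R (\<lambda>k. span (B k - S k))"
  proof (rule subrepresentation_span[OF R])
    show "B k - S k \<subseteq> space R k" if "k \<in> {1..n}" for k using BR[OF that] by blast
    show "act R (Alpha k) ` (B k - S k) \<subseteq> insert 0 (B (Suc k) - S (Suc k))" if "k \<in> {1..<n}" for k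
      using Alpha[OF that] by blast
    show "act R (Beta k) ` (B (Suc k) - S (Suc k)) \<subseteq> insert 0 (B k - S k)" if "k \<in> {1..<n}" for k
      using Beta[OF that] by blast
  qed
qed

text \<open>
The strand and its complement split the representation, and the strand contains \<open>a \<noteq> 0\<close>, so the
complement is empty.
\<close>

lemma indecomposable_basis_subset_strand:
  assumes ind: "indecomposable scale (AA n) R" and B: "string_basis scale n R B"
    and i: "\<And>k. 1 \<le> k \<Longrightarrow> k < i \<Longrightarrow> B k = {}" and a: "a \<in> B i" "i \<in> {1..n}"
    and k: "k \<in> {1..n}" and b: "b \<in> B k"
  shows "strand R B i a k b"
proof -
  have R: "Defs.representation scale (AA n) R" using ind by (simp add: indecomposable_def)
  let ?S = "\<lambda>k. {b. strand R B i a k b}"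
  have SB: "?S k \<union> (B k - ?S k) = B k" for k using strand_in_basis[of R B i a k] a(1) by auto
  have "direct_sum_decomposition (AA n) R (\<lambda>k. span (?S k)) (\<lambda>k. span (B k - ?S k))"
    unfolding direct_sum_decomposition_def
  proof (intro ballI conjI)
    fix q assume "q \<in> verts (AA n)"
    then have Bq: "independent (B q)" "span (B q) = space R q"
      using B by (simp_all add: string_basis_def AA_def)
    have "space R q = span (?S q \<union> (B q - ?S q))" by (simp only: SB Bq(2))
    then show "space R q = {u + w |u w. u \<in> span (?S q) \<and> w \<in> span (B q - ?S q)}"
      unfolding span_Un by auto
    show "span (?S q) \<inter> span (B q - ?S q) = {0}"
      by (rule trivial_span_Int) (simp_all only: SB Bq(1) Diff_disjoint not_False_eq_True)
  qed
  then have "zero_family (AA n) (\<lambda>k. span (?S k)) \<or> zero_family (AA n) (\<lambda>k. span (B k - ?S k))"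
    using ind strand_complement_closed[OF R B i a] unfolding indecomposable_def by blast
  moreover have "\<not> zero_family (AA n) (\<lambda>k. span (?S k))"
  proof
    assume "zero_family (AA n) (\<lambda>k. span (?S k))"
    then have "span (?S i) = {0}" using a(2) by (simp add: zero_family_def AA_def)
    moreover have "a \<in> span (?S i)" by (rule span_base) (simp add: strand.start)
    ultimately show False using zero_notin_string_basis[OF B a(2)] a(1) by auto
  qed
  ultimately have "zero_family (AA n) (\<lambda>k. span (B k - ?S k))" by blast
  then have zero: "span (B k - ?S k) = {0}" using k by (simp add: zero_family_def AA_def)
  show ?thesis
  proof (rule ccontr)
    assume "\<not> strand R B i a k b"
    then have "b \<in> span (B k - ?S k)" using b by (intro span_base) simp
    then show False using zero zero_notin_string_basis[OF B k] b by auto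
  qed
qed

text \<open>
Starting the strand at the lowest occupied vertex \<open>i\<close>, the whole basis is this strand, which has at
most one point over each vertex. Going down from the highest occupied vertex \<open>j\<close>, each point was
reached from one below it, so every vertex from \<open>i\<close> to \<open>j\<close> is occupied.
\<close>

lemma indecomposable_single_string:
  assumes ind: "indecomposable scale (AA n) R" and B: "string_basis scale n R B"
  obtains i j b where "1 \<le> i" "i \<le> j" "j \<le> n"
    "\<And>k. k \<in> {i..j} \<Longrightarrow> B k = {b k}" "\<And>k. k \<in> {1..n} \<Longrightarrow> k \<notin> {i..j} \<Longrightarrow> B k = {}"
    "\<And>k. k \<in> {i..<j} \<Longrightarrow> edge R B k (b k) (b (Suc k))"
proof -
  have R: "Defs.representation scale (AA n) R" using ind by (simp add: indecomposable_def)
  have "\<not> zero_family (AA n) (space R)" using ind unfolding indecomposable_def by blast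
  then have "\<exists>q\<in>{1..n}. space R q \<noteq> {0}" by (simp add: zero_family_def AA_def)
  then obtain q where q: "q \<in> {1..n}" "space R q \<noteq> {0}" by blast
  have "span (B q) = space R q" using B q(1) by (simp add: string_basis_def)
  then have "B q \<noteq> {}" using q(2) by auto
  then have ex: "\<exists>k. k \<in> {1..n} \<and> B k \<noteq> {}" using q(1) by blast
  define i where "i = (LEAST k. k \<in> {1..n} \<and> B k \<noteq> {})"
  have i: "i \<in> {1..n}" "B i \<noteq> {}" using LeastI_ex[OF ex] by (simp_all add: i_def)
  have below: "B k = {}" if "1 \<le> k" "k < i" for k
    using not_less_Least[OF that(2)[unfolded i_def]] that i(1) by auto
  obtain a where a: "a \<in> B i" using i(2) by blast
  define b where "b k = (THE x. strand R B i a k x)" for k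
  have str: "strand R B i a k x" if "k \<in> {1..n}" "x \<in> B k" for k x
    using indecomposable_basis_subset_strand[OF ind B below a i(1) that] .
  have b: "x = b k" if "k \<in> {1..n}" "x \<in> B k" for k x
  proof -
    have "strand R B i a k x" using str[OF that] .
    moreover have "y = x" if "strand R B i a k y" for y
      using strand_unique[OF R B _ that] \<open>strand R B i a k x\<close> \<open>k \<in> {1..n}\<close> i(1) by simp
    ultimately have "(THE x. strand R B i a k x) = x" by (rule the_equality)
    then show ?thesis by (simp add: b_def)
  qed
  let ?N = "{k \<in> {1..n}. B k \<noteq> {}}"
  define j where "j = Max ?N"
  have iN: "i \<in> ?N" using i by simp
  have "j \<in> ?N" unfolding j_def by (rule Max_in) (use iN in auto)
  then have j: "j \<in> {1..n}" "B j \<noteq> {}" by simp_all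
  have ij: "i \<le> j" unfolding j_def by (rule Max_ge) (use iN in auto)
  have above: "B k = {}" if "k \<in> {1..n}" "j < k" for k
  proof (rule ccontr)
    assume "B k \<noteq> {}"
    then have "k \<le> j" unfolding j_def by (intro Max_ge) (use that in auto)
    then show False using that by simp
  qed
  have down: "B k \<noteq> {} \<and> edge R B k (b k) (b (Suc k))" if ik: "i \<le> k" "k < n" "B (Suc k) \<noteq> {}" for k
  proof -
    obtain c where c: "c \<in> B (Suc k)" using ik(3) by blast
    have k: "k \<in> {1..n}" "Suc k \<in> {1..n}" using ik i(1) by simp_all
    obtain x where x: "edge R B k x c"
      using strand_Suc_cases[OF str[OF k(2) c]] ik(1) by auto
    then have "x \<in> B k" by (simp add: edge_def)
    then show ?thesis using x b[OF k(1)] b[OF k(2) c] by auto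
  qed
  have ne: "B k \<noteq> {}" if "k \<le> j" "i \<le> k" for k
    using that
  proof (induction rule: inc_induct)
    case (step k)
    then show ?case using down[of k] j(1) by simp
  qed (use j in simp)
  show thesis
  proof (rule that[of i j b])
    show "B k = {b k}" if "k \<in> {i..j}" for k
    proof -
      have "k \<in> {1..n}" using that i(1) j(1) by simp
      then show ?thesis using ne[of k] b[of k] that by auto
    qed
    show "B k = {}" if "k \<in> {1..n}" "k \<notin> {i..j}" for k
      using below[of k] above[of k] that by (cases "k < i") auto
    show "edge R B k (b k) (b (Suc k))" if "k \<in> {i..<j}" for k
      using down[of k] ne[of "Suc k"] that j(1) by simp
  qed (use i j ij in simp_all)
qed

end

text \<open>
The isomorphism takes the coordinate with respect to \<open>b k\<close>. On an edge realised by one arrow, the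
opposite arrow vanishes because the 2-cycle does, just as in \<open>I_rep\<close>.
\<close>

lemma isomorphic_I_rep:
  fixes s :: "complex \<Rightarrow> 'v::ab_group_add \<Rightarrow> 'v"
  assumes vs: "vector_space s" and R: "Defs.representation s (AA n) R" and B: "string_basis s n R B"
    and ij: "1 \<le> i" "j \<le> n"
    and str: "\<And>k. k \<in> {i..j} \<Longrightarrow> B k = {b k}" "\<And>k. k \<in> {1..n} \<Longrightarrow> k \<notin> {i..j} \<Longrightarrow> B k = {}"
    and e: "\<And>k. k \<in> {i..<j} \<Longrightarrow> edge R B k (b k) (b (Suc k))"
  shows "\<exists>\<Sigma>. length \<Sigma> = j - i \<and> isomorphic s (*) (AA n) R (I_rep i j \<Sigma>)"
proof -
  define \<Sigma> where "\<Sigma> = map (\<lambda>k. if act R (Alpha k) (b k) = b (Suc k) then Plus else Minus) [i..<j]"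
  interpret vector_space s by fact
  define \<phi> where "\<phi> k x = (if i \<le> k \<and> k \<le> j then representation {b k} x (b k) else 0)" for k x
  have sp_in: "space R k = range (\<lambda>c. s c (b k))" if "k \<in> {i..j}" for k
  proof -
    have "space R k = span (B k)" using B that ij by (simp add: string_basis_def)
    then show ?thesis using str(1)[OF that] by (simp add: span_singleton)
  qed
  have sp_out: "space R k = {0}" if "k \<in> {1..n}" "k \<notin> {i..j}" for k
  proof -
    have "space R k = span (B k)" using B that(1) by (simp add: string_basis_def)
    then show ?thesis using str(2)[OF that] by simp
  qed
  have \<phi>: "\<phi> k (s c (b k)) = c" if "k \<in> {i..j}" for k c
  proof -
    have "independent {b k}" using B that ij str(1)[OF that] by (metis atLeastAtMost_iff order_trans string_basis_def)
    moreover have "b k \<in> span {b k}" by (rule span_base) simp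
    ultimately show ?thesis
      using that by (simp add: \<phi>_def representation_scale representation_basis)
  qed
  have lin: "linear_on s (*) (space R k) (space (I_rep i j \<Sigma>) k) (\<phi> k)" if k: "k \<in> {1..n}" for k
  proof (cases "k \<in> {i..j}")
    case True
    have "\<phi> k (s c (b k) + s d (b k)) = c + d" for c d
      using \<phi>[OF True, of "c + d"] by (simp add: scale_left_distrib)
    moreover have "\<phi> k (s c (s d (b k))) = c * d" for c d
      using \<phi>[OF True, of "c * d"] by simp
    ultimately show ?thesis
      using True by (auto simp: linear_on_def sp_in[OF True] I_rep_def \<phi>[OF True])
  next
    case False
    then show ?thesis by (auto simp: linear_on_def I_rep_def \<phi>_def)
  qed
  have bij: "bij_betw (\<phi> k) (space R k) (space (I_rep i j \<Sigma>) k)" if k: "k \<in> {1..n}" for k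
  proof (cases "k \<in> {i..j}")
    case True
    then have "space (I_rep i j \<Sigma>) k = UNIV" by (simp add: I_rep_def)
    moreover have "bij_betw (\<phi> k) (range (\<lambda>c. s c (b k))) UNIV"
      by (rule bij_betw_byWitness[of _ "\<lambda>c. s c (b k)"]) (auto simp: \<phi>[OF True])
    ultimately show ?thesis by (simp only: sp_in[OF True])
  next
    case False
    then have "\<not> (i \<le> k \<and> k \<le> j)" by simp
    then show ?thesis using sp_out[OF k False] by (simp add: I_rep_def \<phi>_def bij_betw_def del: not_le de_Morgan_conj)
  qed
  have \<phi>0: "\<phi> k 0 = 0" if "k \<in> {1..n}" for k
    using lin[OF that] \<phi>[of k 0] by (cases "k \<in> {i..j}") (auto simp: \<phi>_def)
  have nth: "\<Sigma> ! (k - i) = (if act R (Alpha k) (b k) = b (Suc k) then Plus else Minus)"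
    if "i \<le> k" "k < j" for k
    using that by (simp add: \<Sigma>_def)
  have linA: "linear_on s s (space R k) (space R (Suc k)) (act R (Alpha k))"
    and linB: "linear_on s s (space R (Suc k)) (space R k) (act R (Beta k))" if "k \<in> {1..<n}" for k
    using R that by (simp_all add: representation_AA_iff)
  have act0: "act R (Alpha k) 0 = 0" "act R (Beta k) 0 = 0" if k: "k \<in> {1..<n}" for k
  proof -
    have "0 \<in> space R k" "0 \<in> space R (Suc k)"
      using R k by (auto simp: representation_AA_iff intro: subspace_0)
    then have "act R (Alpha k) (s 0 0) = s 0 (act R (Alpha k) 0)"
      "act R (Beta k) (s 0 0) = s 0 (act R (Beta k) 0)"
      using linA[OF k] linB[OF k] by (simp_all only: linear_on_def)
    then show "act R (Alpha k) 0 = 0" "act R (Beta k) 0 = 0" by simp_all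
  qed
  have onA: "\<phi> (Suc k) (act R (Alpha k) x) = act (I_rep i j \<Sigma>) (Alpha k) (\<phi> k x)"
    if k: "k \<in> {1..<n}" and x: "x \<in> space R k" for k x
  proof -
    have kn: "k \<in> {1..n}" "Suc k \<in> {1..n}" using k by simp_all
    consider "k \<notin> {i..j}" | "k \<in> {i..j}" "k = j" | "i \<le> k" "k < j" by fastforce
    then show ?thesis
    proof cases
      case 1
      then have "x = 0" using sp_out[OF kn(1)] x by blast
      then show ?thesis using 1 act0[OF k] \<phi>0 kn by (simp add: I_rep_def)
    next
      case 2
      have "act R (Alpha k) x \<in> space R (Suc k)" using linA[OF k] x by (auto simp: linear_on_def)
      then have "act R (Alpha k) x = 0" using sp_out[OF kn(2)] 2 by simp
      then show ?thesis using 2 \<phi>0 kn by (simp add: I_rep_def)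
    next
      case 3
      then have m: "k \<in> {i..j}" "Suc k \<in> {i..j}" by simp_all
      obtain c where c: "x = s c (b k)" using x sp_in[OF m(1)] by blast
      have bk: "b k \<in> space R k" using basis_in_space[OF B kn(1)] str(1)[OF m(1)] by simp
      have ax: "act R (Alpha k) x = s c (act R (Alpha k) (b k))"
        using linA[OF k] bk c by (simp add: linear_on_def)
      show ?thesis
      proof (cases "act R (Alpha k) (b k) = b (Suc k)")
        case True
        then show ?thesis using 3 ax c \<phi>[OF m(1)] \<phi>[OF m(2)] by (simp add: I_rep_def nth)
      next
        case False
        then have "act R (Beta k) (b (Suc k)) = b k" using e[of k] 3 by (simp add: edge_def)
        then have "act R (Alpha k) (b k) = 0"
          using two_cycle_on_basis(2)[OF R B k, of "b (Suc k)"] str(1)[OF m(2)] by simp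
        then show ?thesis using 3 ax False \<phi>0[OF kn(2)] by (simp add: I_rep_def nth)
      qed
    qed
  qed
  have onB: "\<phi> k (act R (Beta k) x) = act (I_rep i j \<Sigma>) (Beta k) (\<phi> (Suc k) x)"
    if k: "k \<in> {1..<n}" and x: "x \<in> space R (Suc k)" for k x
  proof -
    have kn: "k \<in> {1..n}" "Suc k \<in> {1..n}" using k by simp_all
    consider "Suc k \<notin> {i..j}" | "Suc k \<in> {i..j}" "Suc k = i" | "i \<le> k" "k < j" by fastforce
    then show ?thesis
    proof cases
      case 1
      then have "x = 0" using sp_out[OF kn(2)] x by blast
      then show ?thesis using 1 act0[OF k] \<phi>0 kn by (auto simp: I_rep_def)
    next
      case 2
      have "act R (Beta k) x \<in> space R k" using linB[OF k] x by (auto simp: linear_on_def)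
      then have "act R (Beta k) x = 0" using sp_out[OF kn(1)] 2 by simp
      then show ?thesis using 2 \<phi>0 kn by (auto simp: I_rep_def)
    next
      case 3
      then have m: "k \<in> {i..j}" "Suc k \<in> {i..j}" by simp_all
      obtain c where c: "x = s c (b (Suc k))" using x sp_in[OF m(2)] by blast
      have bk: "b (Suc k) \<in> space R (Suc k)" using basis_in_space[OF B kn(2)] str(1)[OF m(2)] by simp
      have ax: "act R (Beta k) x = s c (act R (Beta k) (b (Suc k)))"
        using linB[OF k] bk c by (simp add: linear_on_def)
      show ?thesis
      proof (cases "act R (Alpha k) (b k) = b (Suc k)")
        case True
        then have "act R (Beta k) (b (Suc k)) = 0"
          using two_cycle_on_basis(1)[OF R B k, of "b k"] str(1)[OF m(1)] by simp
        then show ?thesis using 3 ax True \<phi>0[OF kn(1)] by (simp add: I_rep_def nth)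
      next
        case False
        then have "act R (Beta k) (b (Suc k)) = b k" using e[of k] 3 by (simp add: edge_def)
        then show ?thesis using 3 ax c False \<phi>[OF m(1)] \<phi>[OF m(2)] by (simp add: I_rep_def nth)
      qed
    qed
  qed
  have "isomorphic s (*) (AA n) R (I_rep i j \<Sigma>)"
    unfolding isomorphic_def
  proof (intro exI[of _ \<phi>] conjI ballI)
    fix q assume "q \<in> verts (AA n)"
    then have "q \<in> {1..n}" by (simp add: AA_def)
    then show "linear_on s (*) (space R q) (space (I_rep i j \<Sigma>) q) (\<phi> q)"
      "bij_betw (\<phi> q) (space R q) (space (I_rep i j \<Sigma>) q)" using lin bij by blast+
  next
    fix a x assume a: "a \<in> arcs (AA n)" and x: "x \<in> space R (tail (AA n) a)"
    then consider k where "a = Alpha k" "k \<in> {1..<n}" | k where "a = Beta k" "k \<in> {1..<n}"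
      by (auto simp: AA_def)
    then show "\<phi> (head (AA n) a) (act R a x) = act (I_rep i j \<Sigma>) a (\<phi> (tail (AA n) a) x)"
      using x onA onB by cases (simp_all add: AA_def)
  qed
  moreover have "length \<Sigma> = j - i" by (simp add: \<Sigma>_def)
  ultimately show ?thesis by blast
qed

lemma isomorphic_I_rep_if_indecomposable:
  fixes s :: "complex \<Rightarrow> 'v::ab_group_add \<Rightarrow> 'v"
  assumes "vector_space s" "n \<ge> 1" and V: "indecomposable s (AA n) V"
  shows "\<exists>i j \<Sigma>. 1 \<le> i \<and> i \<le> j \<and> j \<le> n \<and> length \<Sigma> = j - i \<and>
    isomorphic s (*) (AA n) V (I_rep i j \<Sigma>)"
proof -
  interpret vector_space s by fact
  have R: "Defs.representation s (AA n) V" using V unfolding indecomposable_def by blast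
  then have "subspace (space V n)" using assms(2) by (simp add: representation_AA_iff)
  then have "flag s (space V n) {{0}, space V n}"
    using subspace_0 by (auto simp: flag_def)
  then obtain B where B: "string_basis s n V B"
    using exists_string_basis[OF assms(2) R] by blast
  obtain i j b where *: "1 \<le> i" "i \<le> j" "j \<le> n"
    "\<And>k. k \<in> {i..j} \<Longrightarrow> B k = {b k}" "\<And>k. k \<in> {1..n} \<Longrightarrow> k \<notin> {i..j} \<Longrightarrow> B k = {}"
    "\<And>k. k \<in> {i..<j} \<Longrightarrow> edge V B k (b k) (b (Suc k))"
    by (rule indecomposable_single_string[OF V B]) (rule that; assumption)
  show ?thesis
    using isomorphic_I_rep[OF assms(1) R B *(1) *(3) *(4) *(5) *(6)] *(1-3) by blast
qed

section \<open>Isomorphism classes and finite type\<close>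

lemma isomorphic_trans:
  assumes "isomorphic s t Q V W" "isomorphic t u Q W X"
    and wf: "\<forall>a\<in>arcs Q. tail Q a \<in> verts Q \<and> head Q a \<in> verts Q"
  shows "isomorphic s u Q V X"
proof -
  obtain \<phi> where \<phi>: "\<And>q. q \<in> verts Q \<Longrightarrow> linear_on s t (space V q) (space W q) (\<phi> q) \<and>
        bij_betw (\<phi> q) (space V q) (space W q)"
     "\<And>a x. a \<in> arcs Q \<Longrightarrow> x \<in> space V (tail Q a) \<Longrightarrow>
        \<phi> (head Q a) (act V a x) = act W a (\<phi> (tail Q a) x)"
    using assms(1) unfolding isomorphic_def by blast
  obtain \<psi> where \<psi>: "\<And>q. q \<in> verts Q \<Longrightarrow> linear_on t u (space W q) (space X q) (\<psi> q) \<and>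
        bij_betw (\<psi> q) (space W q) (space X q)"
     "\<And>a x. a \<in> arcs Q \<Longrightarrow> x \<in> space W (tail Q a) \<Longrightarrow>
        \<psi> (head Q a) (act W a x) = act X a (\<psi> (tail Q a) x)"
    using assms(2) unfolding isomorphic_def by blast
  show ?thesis
    unfolding isomorphic_def
  proof (intro exI[of _ "\<lambda>q. \<psi> q \<circ> \<phi> q"] conjI ballI)
    fix q assume q: "q \<in> verts Q"
    show "bij_betw (\<psi> q \<circ> \<phi> q) (space V q) (space X q)"
      using bij_betw_trans \<phi>(1)[OF q] \<psi>(1)[OF q] by blast
    show "linear_on s u (space V q) (space X q) (\<psi> q \<circ> \<phi> q)"
      using \<phi>(1)[OF q] \<psi>(1)[OF q] by (auto simp: linear_on_def image_subset_iff)
  next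
    fix a x assume a: "a \<in> arcs Q" and x: "x \<in> space V (tail Q a)"
    have "\<phi> (tail Q a) x \<in> space W (tail Q a)"
      using \<phi>(1)[of "tail Q a"] wf a x by (auto simp: linear_on_def)
    then show "(\<psi> (head Q a) \<circ> \<phi> (head Q a)) (act V a x) = act X a ((\<psi> (tail Q a) \<circ> \<phi> (tail Q a)) x)"
      using \<phi>(2)[OF a x] \<psi>(2)[OF a] by simp
  qed
qed

text \<open>
The inverse maps are linear and commute with the arrows because the spaces of \<open>V\<close> are closed under
the operations and the arrows. This covers the case that \<open>W\<close> is a model such as \<open>I_rep\<close>.
\<close>

lemma isomorphic_sym:
  assumes "vector_space s" "Defs.representation s Q V" "isomorphic s t Q V W"
    and wf: "\<forall>a\<in>arcs Q. tail Q a \<in> verts Q \<and> head Q a \<in> verts Q"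
  shows "isomorphic t s Q W V"
proof -
  interpret vector_space s by fact
  obtain \<phi> where \<phi>: "\<And>q. q \<in> verts Q \<Longrightarrow> linear_on s t (space V q) (space W q) (\<phi> q)"
     "\<And>q. q \<in> verts Q \<Longrightarrow> bij_betw (\<phi> q) (space V q) (space W q)"
     "\<And>a x. a \<in> arcs Q \<Longrightarrow> x \<in> space V (tail Q a) \<Longrightarrow>
        \<phi> (head Q a) (act V a x) = act W a (\<phi> (tail Q a) x)"
    using assms(3) unfolding isomorphic_def by blast
  define \<psi> where "\<psi> q = inv_into (space V q) (\<phi> q)" for q
  have left: "\<psi> q (\<phi> q x) = x" if "q \<in> verts Q" "x \<in> space V q" for q x
    unfolding \<psi>_def by (rule bij_betw_inv_into_left[OF \<phi>(2)[OF that(1)] that(2)])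
  have surj: "\<exists>x\<in>space V q. y = \<phi> q x" if "q \<in> verts Q" "y \<in> space W q" for q y
    using bij_betw_imp_surj_on[OF \<phi>(2)[OF that(1)]] that(2) by blast
  show ?thesis
    unfolding isomorphic_def
  proof (intro exI[of _ \<psi>] conjI ballI)
    fix q assume q: "q \<in> verts Q"
    show bij: "bij_betw (\<psi> q) (space W q) (space V q)"
      using \<phi>(2)[OF q] by (simp add: \<psi>_def bij_betw_inv_into)
    have sub: "subspace (space V q)" using assms(2) q by (simp add: Defs.representation_def)
    show "linear_on t s (space W q) (space V q) (\<psi> q)"
      unfolding linear_on_def
    proof (intro conjI ballI allI)
      show "\<psi> q ` space W q \<subseteq> space V q" using bij by (simp add: bij_betw_def)
    next
      fix y y' assume "y \<in> space W q" "y' \<in> space W q"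
      then obtain x x' where x: "x \<in> space V q" "y = \<phi> q x" "x' \<in> space V q" "y' = \<phi> q x'"
        using surj[OF q] by metis
      then have "y + y' = \<phi> q (x + x')" using \<phi>(1)[OF q] by (simp add: linear_on_def)
      then show "\<psi> q (y + y') = \<psi> q y + \<psi> q y'"
        using x left[OF q] subspace_add[OF sub x(1,3)] by simp
    next
      fix c y assume "y \<in> space W q"
      then obtain x where x: "x \<in> space V q" "y = \<phi> q x" using surj[OF q] by metis
      then have "t c y = \<phi> q (s c x)" using \<phi>(1)[OF q] by (simp add: linear_on_def)
      then show "\<psi> q (t c y) = s c (\<psi> q y)"
        using x left[OF q] subspace_scale[OF sub x(1)] by simp
    qed
  next
    fix a y assume a: "a \<in> arcs Q" and y: "y \<in> space W (tail Q a)"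
    have tq: "tail Q a \<in> verts Q" and hq: "head Q a \<in> verts Q" using wf a by auto
    obtain x where x: "x \<in> space V (tail Q a)" "y = \<phi> (tail Q a) x" using surj[OF tq y] by blast
    have "act V a x \<in> space V (head Q a)"
      using assms(2) a x(1) unfolding Defs.representation_def linear_on_def by (metis image_subset_iff)
    then show "\<psi> (head Q a) (act W a y) = act V a (\<psi> (tail Q a) y)"
      using \<phi>(3)[OF a x(1)] x(2) left[OF tq x(1)] left[OF hq] by metis
  qed
qed

text \<open>
The class of \<open>V\<close> is determined by any label \<open>t\<close> with \<open>V\<close> isomorphic to \<open>M t\<close>: it is the set of all
indecomposables isomorphic to \<open>M t\<close>. So there are at most as many classes as labels.
\<close>

lemma finite_rep_typeI:
  fixes M :: "'t \<Rightarrow> ('q, 'a, 'w::ab_group_add) rep"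
  assumes "vector_space s" and wf: "\<forall>a\<in>arcs Q. tail Q a \<in> verts Q \<and> head Q a \<in> verts Q"
    and "finite T" and M: "\<And>V. indecomposable s Q V \<Longrightarrow> \<exists>t\<in>T. isomorphic s r Q V (M t)"
  shows "finite_rep_type s Q"
proof -
  have cls: "isomorphic s s Q V W \<longleftrightarrow> isomorphic s r Q W (M t)"
    if "indecomposable s Q V" "indecomposable s Q W" "isomorphic s r Q V (M t)" for V W t
  proof -
    have "Defs.representation s Q V" "Defs.representation s Q W" using that by (auto simp: indecomposable_def)
    then show ?thesis
      using that(3) isomorphic_sym[OF assms(1) _ _ wf] isomorphic_trans[OF _ _ wf] by metis
  qed
  let ?I = "{V. indecomposable s Q V}"
  let ?r = "{(V, W). indecomposable s Q V \<and> indecomposable s Q W \<and> isomorphic s s Q V W}"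
  have "?I // ?r \<subseteq> (\<lambda>t. {W. indecomposable s Q W \<and> isomorphic s r Q W (M t)}) ` T"
  proof
    fix c assume "c \<in> ?I // ?r"
    then obtain V where V: "indecomposable s Q V" "c = ?r `` {V}" by (auto elim: quotientE)
    obtain t where t: "t \<in> T" "isomorphic s r Q V (M t)" using M[OF V(1)] by blast
    have "c = {W. indecomposable s Q W \<and> isomorphic s r Q W (M t)}"
      using cls[OF V(1) _ t(2)] V by auto
    then show "c \<in> (\<lambda>t. {W. indecomposable s Q W \<and> isomorphic s r Q W (M t)}) ` T" using t(1) by blast
  qed
  then show ?thesis unfolding finite_rep_type_def using assms(3) finite_surj by blast
qed

lemma finite_interval_signs:
  "finite {(i, j, \<Sigma> :: sign list). 1 \<le> i \<and> i \<le> j \<and> j \<le> n \<and> length \<Sigma> = j - i}"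
proof -
  have "finite (UNIV :: sign set)"
    by (rule finite_subset[of _ "{Plus, Minus}"]) (auto intro: sign.exhaust)
  then have "finite {\<Sigma> :: sign list. set \<Sigma> \<subseteq> UNIV \<and> length \<Sigma> \<le> n}" by (rule finite_lists_length_le)
  then have "finite ({..n} \<times> {..n} \<times> {\<Sigma> :: sign list. set \<Sigma> \<subseteq> UNIV \<and> length \<Sigma> \<le> n})" by simp
  then show ?thesis by (rule rev_finite_subset) auto
qed

theorem theorem2p13:
  fixes n :: nat and s :: "complex \<Rightarrow> 'v::ab_group_add \<Rightarrow> 'v"
  assumes "n \<ge> 1" and "vector_space s"
  shows "(\<forall>V. indecomposable s (AA n) V \<longrightarrow>
            (\<exists>i j \<Sigma>. 1 \<le> i \<and> i \<le> j \<and> j \<le> n \<and> length \<Sigma> = j - i \<and>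
               isomorphic s (*) (AA n) V (I_rep i j \<Sigma>)))
         \<and> finite_rep_type s (AA n)"
proof
  show classified: "\<forall>V. indecomposable s (AA n) V \<longrightarrow>
    (\<exists>i j \<Sigma>. 1 \<le> i \<and> i \<le> j \<and> j \<le> n \<and> length \<Sigma> = j - i \<and>
      isomorphic s (*) (AA n) V (I_rep i j \<Sigma>))"
    using isomorphic_I_rep_if_indecomposable[OF assms(2,1)] by blast
  show "finite_rep_type s (AA n)"
  proof (rule finite_rep_typeI[OF assms(2) _ finite_interval_signs[of n]])
    show "\<forall>a\<in>arcs (AA n). tail (AA n) a \<in> verts (AA n) \<and> head (AA n) a \<in> verts (AA n)"
      by (auto simp: AA_def)
    show "\<exists>t\<in>{(i, j, \<Sigma>). 1 \<le> i \<and> i \<le> j \<and> j \<le> n \<and> length \<Sigma> = j - i}.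
        isomorphic s (*) (AA n) V (case t of (i, j, \<Sigma>) \<Rightarrow> I_rep i j \<Sigma>)"
      if "indecomposable s (AA n) V" for V
    proof -
      from classified that obtain i j \<Sigma> where "1 \<le> i" "i \<le> j" "j \<le> n" "length \<Sigma> = j - i"
        "isomorphic s (*) (AA n) V (I_rep i j \<Sigma>)"
        by blast
      then show ?thesis by (intro bexI[of _ "(i, j, \<Sigma>)"]) simp_all
    qed
  qed
qed

end
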